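(* Let $q=p^h$ with $p>3$ prime, $h\ge1$, $n\ge2$, $1\le k\le n-1$. Let $c\in C_k(n,q)$ have weight smaller than $2q^k$ with $(c,S)\neq0$ for some $(n-k)$-dimensional subspace $S$. Then every subspace of $PG(n,q)$ that meets $supp(c)$ in at least one point meets it in $1\pmod p$ points.
   Context: $C_k(n,q)$ is the $p$-ary linear code spanned over $\mathbb{F}_p$ by the rows of the incidence matrix of $k$-dimensional subspaces versus points of $PG(n,q)$ (entry $1$ iff the point lies in the subspace); codewords are vectors indexed by points. $supp(c)$ is the set of points with nonzero coordinate, the weight is $|supp(c)|$, and $(c,S)=\sum_{P\in S}c_P\in\mathbb{F}_p$. *)

theory Defs
  imports "HOL-Analysis.Analysis" "HOL-Number_Theory.Cong" "HOL-Computational_Algebra.Primes"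
begin

text \<open>
  The geometry \<open>PG(n,q)\<close> is built on the vector space \<open>'a ^ 'n\<close> with \<open>CARD('a) = q\<close> and
  \<open>CARD('n) = n + 1\<close>; its points are the one-dimensional linear subspaces.
\<close>

typedef (overloaded) ('a::field, 'n::finite) proj_point =
  "{L :: ('a ^ 'n) set. vec.subspace L \<and> vec.dim L = 1}"
proof -
  fix i :: 'n
  have "axis i (1 :: 'a) \<noteq> 0"
    by simp
  then have "vec.dim (vec.span {axis i (1 :: 'a)}) = 1"
    by (subst vec.dim_span, subst vec.dim_eq_card_independent) simp_all
  then show ?thesis
    using vec.subspace_span by blast
qed

instance proj_point :: ("{field, finite}", finite) finite
proof
  have "inj (Rep_proj_point :: ('a, 'b) proj_point \<Rightarrow> _)"
    by (simp add: inj_def Rep_proj_point_inject)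
  then show "finite (UNIV :: ('a, 'b) proj_point set)"
    using finite_imageD finite by blast
qed

definition points_of :: "('a::field ^ 'n::finite) set \<Rightarrow> ('a, 'n) proj_point set" where
  "points_of U = {P. Rep_proj_point P \<subseteq> U}"

text \<open>Projective subspaces are identified with their point sets; the empty subspace is included.\<close>

definition proj_subspaces :: "('a::field, 'n::finite) proj_point set set" where
  "proj_subspaces = {points_of U | U. vec.subspace U}"

text \<open>The projective dimension is one less than the linear dimension.\<close>

definition proj_subspaces_dim :: "nat \<Rightarrow> ('a::field, 'n::finite) proj_point set set" where
  "proj_subspaces_dim k = {points_of U | U. vec.subspace U \<and> vec.dim U = k + 1}"

definition incidence_vec :: "'i::finite set \<Rightarrow> 'f::zero_neq_one ^ 'i" where
  "incidence_vec S = (\<chi> P. if P \<in> S then 1 else 0)"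

text \<open>
  The code \<open>C\<^sub>k(n,q)\<close>; the type \<open>'f\<close> is the field of scalars, to be taken as the field with
  \<open>p\<close> elements.
\<close>

definition subspace_code ::
    "nat \<Rightarrow> ('f::field ^ ('a::{field, finite}, 'n::finite) proj_point) set" where
  "subspace_code k = vec.span (incidence_vec ` proj_subspaces_dim k)"

definition supp :: "'f::zero ^ 'i::finite \<Rightarrow> 'i set" where
  "supp c = {P. c $ P \<noteq> 0}"

definition weight :: "'f::zero ^ 'i::finite \<Rightarrow> nat" where
  "weight c = card (supp c)"

definition sum_on :: "'f::comm_monoid_add ^ 'i::finite \<Rightarrow> 'i set \<Rightarrow> 'f" where
  "sum_on c S = (\<Sum>P\<in>S. c $ P)"

end

theory Submission
  imports "HOL-Algebra.Algebraic_Closure_Type" "HOL-Number_Theory.Residues" Defs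
begin

text \<open>
  A \<open>k\<close>-space meets every \<open>(n-k)\<close>-space in \<open>1\<close> modulo \<open>p\<close> points, so all \<open>(n-k)\<close>-spaces take the
  same value \<open>\<alpha> \<noteq> 0\<close> on \<open>c\<close>. Let \<open>K\<close> be the field with \<open>q\<^sup>k\<close> elements. The kernel of a linear
  map into \<open>K\<close> contains an \<open>(n-k)\<close>-space. Because the weight is less than \<open>2q\<^sup>k\<close>, averaging over the
  maps vanishing on a subspace \<open>L\<close> gives an \<open>(n-k)\<close>-space through \<open>L\<close> with at most one point of the
  support outside \<open>L\<close>. For \<open>L\<close> a point \<open>R\<close> of the support with \<open>c\<^sub>R \<noteq> \<alpha>\<close>, this \<open>(n-k)\<close>-space meets
  the support in \<open>R\<close> and one more point \<open>S\<close>; the polynomial method over \<open>K\<close> then finds an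
  \<open>(n-k)\<close>-space that meets the support in at most one of \<open>R\<close> and \<open>S\<close> and in nothing else, so its
  value on \<open>c\<close> is not \<open>\<alpha>\<close>. Hence \<open>c\<close> equals \<open>\<alpha>\<close> on its support, and every \<open>(n-k)\<close>-space
  meets the support in \<open>1\<close> modulo \<open>p\<close> points. For \<open>L\<close> a line, it follows that \<open>L\<close> meets the
  support in \<open>0\<close> or \<open>1\<close> modulo \<open>p\<close> points; if \<open>L\<close> meets the support, the first case produces a
  line with exactly two points of the support, which is absurd. Larger subspaces are partitioned into
  lines through a point of the support.
\<close>

unbundle no fps_syntax

section \<open>Finite subfields\<close>

locale finite_subfield =
  fixes K :: "'b::field set"
  assumes finite_K: "finite K"
    and zero_mem: "0 \<in> K" and one_mem: "1 \<in> K"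
    and add_mem: "x \<in> K \<Longrightarrow> y \<in> K \<Longrightarrow> x + y \<in> K"
    and uminus_mem: "x \<in> K \<Longrightarrow> - x \<in> K"
    and mult_mem: "x \<in> K \<Longrightarrow> y \<in> K \<Longrightarrow> x * y \<in> K"
    and inverse_mem: "x \<in> K \<Longrightarrow> inverse x \<in> K"
begin

lemma of_nat_card_eq_0: "of_nat (card K) = (0 :: 'b)"
proof -
  have "bij_betw (\<lambda>x. x + 1) K K"
    using add_mem[OF _ one_mem] add_mem[OF _ uminus_mem[OF one_mem]]
    by (intro bij_betwI[where g = "\<lambda>x. x + - 1"]) auto
  then have "(\<Sum>x\<in>K. x + 1) = \<Sum>K"
    by (rule sum.reindex_bij_betw[where g = "\<lambda>x. x"])
  then show ?thesis
    by (simp add: sum.distrib)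
qed

lemma exists_power_neq_1:
  assumes "0 < i" and "i < card K - 1"
  obtains g where "g \<in> K" "g \<noteq> 0" "g ^ i \<noteq> 1"
proof -
  let ?p = "monom 1 i - 1 :: 'b poly"
  have "coeff ?p i = 1"
    using assms(1) by simp
  then have "?p \<noteq> 0"
    by (metis coeff_0 zero_neq_one)
  have "degree ?p \<le> i"
    by (simp add: degree_diff_le degree_monom_le)
  then have "card {x. poly ?p x = 0} < card (K - {0})"
    using card_poly_roots_bound[OF \<open>?p \<noteq> 0\<close>] assms(2) zero_mem by simp
  then have "\<not> K - {0} \<subseteq> {x. poly ?p x = 0}"
    using card_mono[OF poly_roots_finite[OF \<open>?p \<noteq> 0\<close>]] by (metis not_le)
  then show thesis
    using that by (auto simp: poly_monom)
qed

lemma sum_power_eq_0: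
  assumes "i < card K - 1"
  shows "(\<Sum>x\<in>K. x ^ i) = 0"
proof (cases "i = 0")
  case True
  then show ?thesis
    using of_nat_card_eq_0 by simp
next
  case False
  then obtain g where g: "g \<in> K" "g \<noteq> 0" "g ^ i \<noteq> 1"
    using exists_power_neq_1 assms by blast
  then have "bij_betw ((*) g) K K"
    using mult_mem inverse_mem
    by (intro bij_betwI[where g = "\<lambda>y. inverse g * y"]) (auto simp flip: mult.assoc)
  then have "(\<Sum>x\<in>K. x ^ i) = (\<Sum>x\<in>K. (g * x) ^ i)"
    by (simp add: sum.reindex_bij_betw[where g = "\<lambda>y. y ^ i"])
  also have "\<dots> = g ^ i * (\<Sum>x\<in>K. x ^ i)"
    by (simp add: power_mult_distrib sum_distrib_left)
  finally show ?thesis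
    using g(3) by simp
qed

lemma sum_monomial_eq_0:
  assumes "finite J" and "sum e J < card J * (card K - 1)"
  shows "(\<Sum>u\<in>J \<rightarrow>\<^sub>E K. \<Prod>j\<in>J. u j ^ e j) = 0"
proof -
  obtain j where "j \<in> J" "e j < card K - 1"
    using assms(2) sum_bounded_below[of J "card K - 1" e] by (force simp: not_less)
  then have "(\<Prod>j\<in>J. \<Sum>x\<in>K. x ^ e j) = 0"
    using assms(1) sum_power_eq_0 by (intro prod_zero) auto
  then show ?thesis
    using assms(1) finite_K by (simp add: prod_sum_PiE)
qed

lemma sum_monomial_mult_prod_affine_eq_0:
  fixes a :: "'x \<Rightarrow> 'b" and b :: "'x \<Rightarrow> 'j \<Rightarrow> 'b"
  assumes "finite J" and "finite A" and "sum e J + card A < card J * (card K - 1)"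
  shows "(\<Sum>u\<in>J \<rightarrow>\<^sub>E K. (\<Prod>j\<in>J. u j ^ e j) * (\<Prod>x\<in>A. a x + (\<Sum>j\<in>J. b x j * u j))) = 0"
  using assms(2,3)
proof (induction A arbitrary: e rule: finite_induct)
  case empty
  then show ?case
    using sum_monomial_eq_0[OF assms(1)] by simp
next
  case (insert x A)
  let ?e' = "\<lambda>j. e(j := Suc (e j))"
  let ?F = "\<lambda>u. \<Prod>x\<in>A. a x + (\<Sum>j\<in>J. b x j * u j)"
  let ?G = "\<lambda>e u. (\<Prod>j\<in>J. u j ^ e j) * ?F u"
  have "(\<Prod>i\<in>J. u i ^ ?e' j i) = u j * (\<Prod>i\<in>J. u i ^ e i)" if "j \<in> J" for u :: "'j \<Rightarrow> 'b" and j
    using that assms(1) by (simp add: prod.remove)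
  then have "(\<Prod>j\<in>J. u j ^ e j) * (\<Prod>x\<in>insert x A. a x + (\<Sum>j\<in>J. b x j * u j))
      = a x * ?G e u + (\<Sum>j\<in>J. b x j * ?G (?e' j) u)" for u
    using insert.hyps by (simp add: ring_distribs sum_distrib_left sum_distrib_right mult_ac)
  then have "(\<Sum>u\<in>J \<rightarrow>\<^sub>E K. (\<Prod>j\<in>J. u j ^ e j) * (\<Prod>x\<in>insert x A. a x + (\<Sum>j\<in>J. b x j * u j)))
      = a x * (\<Sum>u\<in>J \<rightarrow>\<^sub>E K. ?G e u) + (\<Sum>u\<in>J \<rightarrow>\<^sub>E K. \<Sum>j\<in>J. b x j * ?G (?e' j) u)"
    by (simp only: sum.distrib sum_distrib_left)
  also have "(\<Sum>u\<in>J \<rightarrow>\<^sub>E K. \<Sum>j\<in>J. b x j * ?G (?e' j) u) = (\<Sum>j\<in>J. b x j * (\<Sum>u\<in>J \<rightarrow>\<^sub>E K. ?G (?e' j) u))"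
    by (subst sum.swap) (simp only: sum_distrib_left)
  also have "\<dots> = 0"
  proof (intro sum.neutral ballI)
    fix j assume "j \<in> J"
    then have "sum (?e' j) J = Suc (sum e J)"
      using assms(1) by (simp add: sum.remove)
    then show "b x j * (\<Sum>u\<in>J \<rightarrow>\<^sub>E K. ?G (?e' j) u) = 0"
      using insert.IH[of "?e' j"] insert.prems insert.hyps by simp
  qed
  also have "(\<Sum>u\<in>J \<rightarrow>\<^sub>E K. ?G e u) = 0"
    using insert by simp
  finally show ?case
    by simp
qed

text \<open>The theorem of Jamison and of Brouwer and Schrijver: a function on \<open>K\<^sup>J\<close> supported at the
  origin has nonzero sum, while a polynomial of degree less than \<open>\<bar>J\<bar> (\<bar>K\<bar> - 1)\<close> has sum zero.\<close>

lemma affine_functions_common_nonzero: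
  fixes a :: "'x \<Rightarrow> 'b" and b :: "'x \<Rightarrow> 'j \<Rightarrow> 'b"
  assumes "finite J" and "finite A" and "card A < card J * (card K - 1)"
    and a: "\<And>x. x \<in> A \<Longrightarrow> a x \<noteq> 0"
  obtains u where "u \<in> J \<rightarrow> K" "\<exists>j\<in>J. u j \<noteq> 0" "\<And>x. x \<in> A \<Longrightarrow> a x + (\<Sum>j\<in>J. b x j * u j) \<noteq> 0"
proof -
  let ?F = "\<lambda>u. \<Prod>x\<in>A. a x + (\<Sum>j\<in>J. b x j * u j)"
  let ?zero = "\<lambda>j\<in>J. 0 :: 'b"
  have "\<exists>u\<in>J \<rightarrow>\<^sub>E K. u \<noteq> ?zero \<and> ?F u \<noteq> 0"
  proof (rule ccontr)
    assume "\<not> ?thesis"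
    then have "(\<Sum>u\<in>{?zero}. ?F u) = (\<Sum>u\<in>J \<rightarrow>\<^sub>E K. ?F u)"
      using assms(1) finite_K zero_mem by (intro sum.mono_neutral_left finite_PiE) auto
    also have "\<dots> = 0"
      using sum_monomial_mult_prod_affine_eq_0[OF assms(1,2), of "\<lambda>_. 0"] assms(3) by simp
    finally show False
      using a assms(2) by simp
  qed
  then obtain u where u: "u \<in> J \<rightarrow>\<^sub>E K" "u \<noteq> ?zero" "?F u \<noteq> 0"
    by blast
  show thesis
  proof
    show "u \<in> J \<rightarrow> K"
      using u(1) by auto
    show "\<exists>j\<in>J. u j \<noteq> 0"
      using u(1,2) by (metis (no_types, lifting) PiE_ext restrict_apply' restrict_PiE_iff zero_mem)
    show "a x + (\<Sum>j\<in>J. b x j * u j) \<noteq> 0" if "x \<in> A" for x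
      using u(3) that assms(2) by (meson prod_zero_iff)
  qed
qed

end

section \<open>Finite extensions of a finite field\<close>

lemma CARD_gt_1: "CARD('a::{zero_neq_one, finite}) > 1"
  using card_mono[of UNIV "{0, 1 :: 'a}"] by simp

lemma power_CARD_eq_self:
  fixes x :: "'a::{field, finite}"
  shows "x ^ CARD('a) = x"
proof (cases "x = 0")
  case False
  then have "bij_betw ((*) x) (UNIV - {0}) (UNIV - {0})"
    by (intro bij_betwI[where g = "\<lambda>y. y / x"]) auto
  then have "(\<Prod>y\<in>UNIV - {0}. x * y) = \<Prod>(UNIV - {0})"
    by (rule prod.reindex_bij_betw[where g = "\<lambda>y. y"])
  then have "x ^ (CARD('a) - 1) = 1"
    by (simp add: prod.distrib)
  then show ?thesis
    by (metis One_nat_def Suc_pred finite_UNIV_card_ge_0 finite mult_1_right power_Suc)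
qed (simp add: zero_power)

lemma prime_CHAR_finite_field: "prime CHAR('a::{field, finite})"
  by (simp add: finite_imp_CHAR_pos prime_CHAR_semidom)

lemma CHAR_eq_if_CARD_eq_prime_power:
  assumes "prime p" and "CARD('a::{field, finite}) = p ^ h"
  shows "CHAR('a) = p"
proof -
  have "CHAR('a) dvd p ^ h"
    using CHAR_dvd_CARD[where 'a = 'a] assms(2) by simp
  then show ?thesis
    using assms(1) prime_CHAR_finite_field prime_dvd_power primes_dvd_imp_eq by blast
qed

lemma card_roots_eq_degree:
  fixes p :: "'a::alg_closed_field poly"
  assumes simple: "\<And>x. poly p x = 0 \<Longrightarrow> poly (pderiv p) x \<noteq> 0"
  shows "card {x. poly p x = 0} = degree p"
proof -
  have "p \<noteq> 0"
    using simple[of 0] by auto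
  then obtain A where A: "size A = degree p" "p = smult (lead_coeff p) (\<Prod>x\<in>#A. [:-x, 1:])"
    using alg_closed_imp_factorization by blast
  have "lead_coeff p \<noteq> 0"
    using \<open>p \<noteq> 0\<close> by simp
  then have roots: "poly p x = 0 \<longleftrightarrow> x \<in># A" for x
    by (subst A(2)) (auto simp: poly_prod_mset prod_mset_zero_iff)
  have "count A x = 1" if x: "x \<in># A" for x
  proof (rule ccontr)
    assume "count A x \<noteq> 1"
    moreover obtain A' where "A = add_mset x A'"
      using multi_member_split[OF x] by blast
    ultimately obtain A'' where "A = add_mset x (add_mset x A'')"
      by (metis count_add_mset count_eq_zero_iff multi_member_split One_nat_def)
    then have "[:-x, 1:] * [:-x, 1:] dvd p"
      by (subst A(2), intro dvd_smult)
        (simp only: image_mset_add_mset prod_mset.add_mset mult.assoc [symmetric] dvd_triv_left)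
    then obtain r where "p = [:-x, 1:] * [:-x, 1:] * r"
      by (elim dvdE)
    then have "poly (pderiv p) x = 0"
      by (simp only: pderiv_mult poly_add poly_mult) simp
    then show False
      using simple roots x by blast
  qed
  then have "size A = card (set_mset A)"
    by (simp add: size_multiset_overloaded_eq)
  then show ?thesis
    using A(1) roots by simp
qed

lemma card_power_fixed_points:
  assumes "of_nat m = (0 :: 'a::alg_closed_field)" and "m > 1"
  shows "card {x :: 'a. x ^ m = x} = m"
proof -
  let ?p = "monom 1 m - monom 1 1 :: 'a poly"
  have "pderiv ?p = - 1"
    using assms(1) by (simp add: pderiv_diff pderiv_monom)
  then have "card {x. poly ?p x = 0} = degree ?p"
    by (intro card_roots_eq_degree) simp
  moreover have "degree ?p = m"
    using assms(2) degree_add_eq_left[of "- monom 1 1 :: 'a poly" "monom 1 m"]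
    by (simp add: degree_monom_eq)
  ultimately show ?thesis
    by (simp add: poly_monom)
qed

lemma finite_subfield_power_fixed_points:
  assumes "prime CHAR('a::field)" and "m = CHAR('a) ^ j" and "m > 1"
  shows "finite_subfield {x :: 'a. x ^ m = x}"
proof
  note add_power = freshmans_dream'[OF assms(1,2)]
  have "coeff (monom 1 m - monom 1 1 :: 'a poly) m = 1"
    using assms(3) by simp
  then have "monom 1 m - monom 1 1 \<noteq> (0 :: 'a poly)"
    by (metis coeff_0 zero_neq_one)
  from poly_roots_finite[OF this] show "finite {x :: 'a. x ^ m = x}"
    by (simp add: poly_monom)
  show "- x \<in> {x. x ^ m = x}" if "x \<in> {x. x ^ m = x}" for x :: 'a
  proof -
    have "x ^ m + (- x) ^ m = 0"
      using add_power[of x "- x"] assms(3) by (simp add: zero_power)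
    then show ?thesis
      using that by (simp add: eq_neg_iff_add_eq_0 add.commute)
  qed
qed (use assms(3) freshmans_dream'[OF assms(1,2)] in
    \<open>simp_all add: power_mult_distrib power_inverse zero_power\<close>)

locale finite_field_extension = finite_subfield K for K :: "'b::field set" +
  fixes emb :: "'a::{field, finite} \<Rightarrow> 'b" and k :: nat
  assumes emb_mem: "emb a \<in> K"
    and emb_1: "emb 1 = 1"
    and emb_add: "emb (a + a') = emb a + emb a'"
    and emb_mult: "emb (a * a') = emb a * emb a'"
    and card_K: "card K = CARD('a) ^ k"

lemma finite_field_extension_to_ac:
  assumes "CARD('a::{field, finite}) = CHAR('a) ^ h" and "k \<ge> 1"
  shows "finite_field_extension {x. x ^ (CARD('a) ^ k) = x} (to_ac :: 'a \<Rightarrow> 'a alg_closure) k"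
proof -
  let ?Q = "CARD('a) ^ k"
  have CHAR: "prime CHAR('a alg_closure)"
    by (simp add: prime_CHAR_finite_field)
  have Q: "?Q = CHAR('a alg_closure) ^ (h * k)"
    using assms(1) by (simp add: power_mult)
  have "?Q > 1"
    using CARD_gt_1 assms(2) by (intro one_less_power) auto
  moreover have "CHAR('a) dvd ?Q"
    using CHAR_dvd_CARD[where 'a = 'a] assms(2) by (simp add: dvd_trans[OF _ dvd_power])
  then have "of_nat ?Q = (0 :: 'a alg_closure)"
    by (simp only: of_nat_eq_0_iff_char_dvd CHAR_alg_closure)
  ultimately have card: "card {x :: 'a alg_closure. x ^ ?Q = x} = ?Q"
    by (intro card_power_fixed_points)
  interpret finite_subfield "{x :: 'a alg_closure. x ^ ?Q = x}"
    using finite_subfield_power_fixed_points[OF CHAR Q \<open>?Q > 1\<close>] by blast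
  have "a ^ (CARD('a) ^ i) = a" for a :: 'a and i
    by (induction i) (simp_all add: power_mult power_CARD_eq_self)
  then show ?thesis
    using card by unfold_locales (simp_all flip: to_ac_power)
qed

section \<open>Linear algebra\<close>

lemma (in vector_space) card_span:
  assumes "independent B" and "finite B"
  shows "card (span B) = CARD('a) ^ card B"
proof -
  have "bij_betw (\<lambda>u. \<Sum>v\<in>B. scale (u v) v) (B \<rightarrow>\<^sub>E UNIV) (span B)"
  proof (intro bij_betw_imageI inj_onI)
    fix u u' assume uu': "u \<in> B \<rightarrow>\<^sub>E UNIV" "u' \<in> B \<rightarrow>\<^sub>E UNIV"
      and "(\<Sum>v\<in>B. scale (u v) v) = (\<Sum>v\<in>B. scale (u' v) v)"
    then have "(\<Sum>v\<in>B. scale (u v - u' v) v) = 0"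
      by (simp add: scale_left_diff_distrib sum_subtractf)
    then have "u v = u' v" if "v \<in> B" for v
      using independentD[OF assms order_refl, of "\<lambda>v. u v - u' v"] that by simp
    then show "u = u'"
      using uu' by (intro PiE_ext)
  next
    have "(\<Sum>v\<in>B. scale (u v) v) = (\<Sum>v\<in>B. scale (restrict u B v) v)" for u
      by (intro sum.cong) auto
    then show "(\<lambda>u. \<Sum>v\<in>B. scale (u v) v) ` (B \<rightarrow>\<^sub>E UNIV) = span B"
      unfolding span_finite[OF assms(2)] by (auto intro!: image_eqI[of _ _ "restrict _ B"])
  qed
  then have "card (B \<rightarrow>\<^sub>E (UNIV :: 'a set)) = card (span B)"
    by (rule bij_betw_same_card)
  then show ?thesis
    using assms(2) by (simp add: card_PiE)
qed

lemma (in finite_dimensional_vector_space) card_subspace: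
  assumes "subspace U"
  shows "card U = CARD('a) ^ dim U"
proof -
  obtain B where B: "B \<subseteq> U" "independent B" "U \<subseteq> span B" "card B = dim U"
    using basis_exists by blast
  then have "U = span B"
    using assms span_minimal by blast
  then show ?thesis
    using card_span B finiteI_independent by metis
qed

lemma (in finite_dimensional_vector_space) exists_subspace_between:
  assumes "subspace W" and "L \<subseteq> W" and "dim L \<le> d" and "d \<le> dim W"
  obtains U where "subspace U" "L \<subseteq> U" "U \<subseteq> W" "dim U = d"
proof -
  obtain B where B: "B \<subseteq> L" "independent B" "L \<subseteq> span B" "card B = dim L"
    using basis_exists by blast
  obtain C where C: "B \<subseteq> C" "C \<subseteq> W" "independent C" "W \<subseteq> span C"
    using maximal_independent_subset_extend[of B W] B assms(2) by blast
  then have "card C = dim W"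
    using basis_card_eq_dim by blast
  then obtain D where D: "B \<subseteq> D" "D \<subseteq> C" "card D = d"
    using exists_subset_between[of B d C] assms B C finiteI_independent by metis
  show thesis
  proof
    show "subspace (span D)" by simp
    show "L \<subseteq> span D" using B D span_mono by blast
    show "span D \<subseteq> W" using C D assms(1) by (simp add: span_minimal)
    show "dim (span D) = d"
      using D C independent_mono dim_span_eq_card_independent by metis
  qed
qed

lemma (in vector_space) exists_linear_functional:
  assumes "subspace L" and "x \<notin> L"
  obtains g where "Vector_Spaces.linear scale (*) g" "g x = 1" "\<And>u. u \<in> L \<Longrightarrow> g u = 0"
proof -
  obtain B where B: "B \<subseteq> L" "independent B" "L \<subseteq> span B"
    using maximal_independent_subset by blast
  then have "x \<notin> span B"
    using assms span_minimal by blast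
  then have ind: "independent (insert x B)"
    using B(2) by (simp add: independent_insert)
  let ?C = "extend_basis (insert x B)"
  note C = extend_basis_superset[OF ind] independent_extend_basis[OF ind] span_extend_basis[OF ind]
  show thesis
  proof
    show "Vector_Spaces.linear scale (*) (\<lambda>v. representation ?C v x)"
      by (rule linear_representation[OF C(2,3)])
    show "representation ?C x x = 1"
      using representation_basis[OF C(2), of x] C(1) by simp
    show "representation ?C u x = 0" if "u \<in> L" for u
    proof -
      have "representation ?C u = representation B u"
        using C(1,2) B(3) that by (intro representation_extend) auto
      then show ?thesis
        using representation_ne_zero[of B u x] \<open>x \<notin> span B\<close> span_base by fastforce
    qed
  qed
qed

lemma (in vector_space) exists_dual_functionals:
  assumes "independent (v ` J)" and "inj_on v J"
  obtains g where "\<And>i. Vector_Spaces.linear scale (*) (g i)"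
    "\<And>i j. i \<in> J \<Longrightarrow> j \<in> J \<Longrightarrow> g i (v j) = of_bool (j = i)"
proof -
  let ?C = "extend_basis (v ` J)"
  note C = extend_basis_superset[OF assms(1)] independent_extend_basis[OF assms(1)]
    span_extend_basis[OF assms(1)]
  show thesis
  proof
    show "Vector_Spaces.linear scale (*) (\<lambda>x. representation ?C x (v i))" for i
      by (rule linear_representation[OF C(2,3)])
    show "representation ?C (v j) (v i) = of_bool (j = i)" if "i \<in> J" "j \<in> J" for i j
    proof -
      have "v j \<in> ?C"
        using C(1) that(2) by blast
      then show ?thesis
        using representation_basis[OF C(2)] assms(2) that by (auto simp: inj_on_eq_iff)
    qed
  qed
qed

lemma card_range_mult_card_kernel:
  fixes f :: "'a::{ab_group_add, finite} \<Rightarrow> 'b::ab_group_add"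
  assumes "Modules.additive f"
  shows "card (range f) * card {x. f x = 0} = CARD('a)"
proof -
  interpret Modules.additive f by fact
  have "card {x. f x = y} = card {x. f x = 0}" if y: "y \<in> range f" for y
  proof -
    obtain z where "f z = y"
      using y by blast
    then have "bij_betw (\<lambda>x. x + z) {x. f x = 0} {x. f x = y}"
      by (intro bij_betwI[where g = "\<lambda>x. x - z"]) (auto simp: add diff)
    then show ?thesis
      by (simp add: bij_betw_same_card)
  qed
  then show ?thesis
    using sum.image_gen[of UNIV "\<lambda>_. 1 :: nat" f] by simp
qed

section \<open>Projective geometry over a finite field\<close>

definition point_vec :: "('a::field, 'n::finite) proj_point \<Rightarrow> 'a ^ 'n" where
  "point_vec P = (SOME v. v \<in> Rep_proj_point P \<and> v \<noteq> 0)"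

lemma Rep_proj_point_eq_span:
  fixes P :: "('a::field, 'n::finite) proj_point"
  assumes "v \<in> Rep_proj_point P" and "v \<noteq> 0"
  shows "Rep_proj_point P = vec.span {v}"
proof -
  have P: "vec.subspace (Rep_proj_point P)" "vec.dim (Rep_proj_point P) = 1"
    using Rep_proj_point[of P] by auto
  have "vec.dim (vec.span {v}) = 1"
    using assms(2) by (subst vec.dim_span_eq_card_independent) auto
  then show ?thesis
    using P assms vec.subspace_dim_equal[of "vec.span {v}" "Rep_proj_point P"]
    by (simp add: vec.span_minimal)
qed

lemma
  fixes P :: "('a::field, 'n::finite) proj_point"
  shows point_vec_neq_0: "point_vec P \<noteq> 0"
    and span_point_vec: "vec.span {point_vec P} = Rep_proj_point P"
proof -
  have "vec.dim (Rep_proj_point P) = 1"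
    using Rep_proj_point[of P] by auto
  then have "\<not> Rep_proj_point P \<subseteq> {0}"
    by (metis vec.dim_eq_0 zero_neq_one)
  then have "\<exists>v. v \<in> Rep_proj_point P \<and> v \<noteq> 0"
    by blast
  then have "point_vec P \<in> Rep_proj_point P \<and> point_vec P \<noteq> 0"
    unfolding point_vec_def by (rule someI_ex)
  then show "point_vec P \<noteq> 0" and "vec.span {point_vec P} = Rep_proj_point P"
    using Rep_proj_point_eq_span by blast+
qed

lemma inj_point_vec: "inj point_vec"
  by (metis Rep_proj_point_inject injI span_point_vec)

lemma mem_points_of_iff: "vec.subspace U \<Longrightarrow> P \<in> points_of U \<longleftrightarrow> point_vec P \<in> U"
  unfolding points_of_def mem_Collect_eq span_point_vec [symmetric]
  by (metis insert_subset empty_subsetI vec.span_minimal vec.span_superset subset_trans)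

lemma points_of_Int: "points_of U \<inter> points_of W = points_of (U \<inter> W)"
  by (auto simp: points_of_def)

lemma points_of_mono: "U \<subseteq> W \<Longrightarrow> points_of U \<subseteq> points_of W"
  by (auto simp: points_of_def)

lemma point_vec_mem_span_iff: "point_vec P \<in> vec.span {point_vec R} \<longleftrightarrow> P = R"
  by (metis Rep_proj_point_eq_span Rep_proj_point_inject insertI1 point_vec_neq_0 span_point_vec
      vec.span_base)

lemma points_of_span_point_vec: "points_of (vec.span {point_vec R}) = {R}"
  by (simp add: mem_points_of_iff point_vec_mem_span_iff set_eq_iff)

lemma exists_point_containing:
  fixes v :: "'a::field ^ 'n::finite"
  assumes "v \<noteq> 0"
  obtains P where "v \<in> Rep_proj_point P"
proof -
  have "vec.dim (vec.span {v}) = 1"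
    using assms by (subst vec.dim_span_eq_card_independent) auto
  then show thesis
    using that[of "Abs_proj_point (vec.span {v})"] by (simp add: Abs_proj_point_inverse vec.span_base)
qed

lemma card_points_of:
  fixes U :: "('a::{field, finite} ^ 'n::finite) set"
  assumes "vec.subspace U"
  shows "card (points_of U) * (CARD('a) - 1) + 1 = CARD('a) ^ vec.dim U"
proof -
  have "U - {0} = (\<Union>P\<in>points_of U. Rep_proj_point P - {0})"
  proof (intro equalityI subsetI)
    fix v assume v: "v \<in> U - {0}"
    then obtain P where P: "v \<in> Rep_proj_point P"
      using exists_point_containing by blast
    then have "Rep_proj_point P \<subseteq> U"
      using v assms Rep_proj_point_eq_span[OF P] by (simp add: vec.span_minimal)
    then show "v \<in> (\<Union>P\<in>points_of U. Rep_proj_point P - {0})"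
      using P v by (auto simp: points_of_def)
  qed (auto simp: points_of_def)
  also have "card \<dots> = (\<Sum>P\<in>points_of U. card (Rep_proj_point P - {0}))"
  proof (intro card_UN_disjoint ballI impI)
    fix P R :: "('a, 'n) proj_point" assume "P \<noteq> R"
    then show "(Rep_proj_point P - {0}) \<inter> (Rep_proj_point R - {0}) = {}"
      using Rep_proj_point_eq_span[of _ P] Rep_proj_point_eq_span[of _ R]
      by (auto simp flip: Rep_proj_point_inject)
  qed auto
  also have "\<dots> = card (points_of U) * (CARD('a) - 1)"
  proof -
    have "card (Rep_proj_point P - {0}) = CARD('a) - 1" for P :: "('a, 'n) proj_point"
      using Rep_proj_point[of P] by (simp add: vec.card_subspace vec.subspace_0)
    then show ?thesis
      by simp
  qed
  finally have "card (points_of U) * (CARD('a) - 1) + 1 = card U"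
    using vec.subspace_0[OF assms] by (metis Suc_eq_plus1 card_Suc_Diff1 finite)
  then show ?thesis
    using vec.card_subspace[OF assms] by simp
qed

lemma card_points_of_cong_1:
  fixes U :: "('a::{field, finite} ^ 'n::finite) set"
  assumes "vec.subspace U" and "vec.dim U \<ge> 1"
  shows "[card (points_of U) = 1] (mod CARD('a))"
proof -
  let ?N = "card (points_of U)"
  have "CARD('a) dvd ?N * (CARD('a) - 1) + 1"
    using card_points_of[OF assms(1)] assms(2) by (simp add: dvd_power)
  then have "[?N * (CARD('a) - 1) + 1 + ?N = 0 + ?N] (mod CARD('a))"
    by (intro cong_add cong_refl) (simp add: cong_0_iff)
  moreover have "?N * (CARD('a) - 1) + 1 + ?N = 1 + ?N * CARD('a)"
    by (cases "CARD('a)") simp_all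
  ultimately have "[1 + ?N * CARD('a) = ?N] (mod CARD('a))"
    by simp
  then show ?thesis
    by (simp only: Cong.cong_def mod_mult_self1)
qed

lemma card_proj_subspaces_Int_cong_1:
  fixes V Y :: "('a::{field, finite}, 'n::finite) proj_point set"
  assumes "CARD('n) = n + 1" and "k \<le> n"
    and "V \<in> proj_subspaces_dim k" and "Y \<in> proj_subspaces_dim (n - k)"
  shows "[card (V \<inter> Y) = 1] (mod CARD('a))"
proof -
  obtain U W where U: "V = points_of U" "vec.subspace U" "vec.dim U = k + 1"
    and W: "Y = points_of W" "vec.subspace W" "vec.dim W = n - k + 1"
    using assms(3,4) by (auto simp: proj_subspaces_dim_def)
  have "vec.dim {x + y |x y. x \<in> U \<and> y \<in> W} \<le> n + 1"
    using dim_subset_UNIV_cart_gen[of "{x + y |x y. x \<in> U \<and> y \<in> W}"] assms(1) by simp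
  then have "vec.dim (U \<inter> W) \<ge> 1"
    using vec.dim_sums_Int[OF U(2) W(2)] U(3) W(3) assms(2) by linarith
  then show ?thesis
    using card_points_of_cong_1 vec.subspace_inter[OF U(2) W(2)] by (simp add: U(1) W(1) points_of_Int)
qed

lemma proj_subspaces_dim_subset_proj_subspaces: "proj_subspaces_dim d \<subseteq> proj_subspaces"
  by (auto simp: proj_subspaces_dim_def proj_subspaces_def)

definition proj_line :: "('a::field, 'n::finite) proj_point \<Rightarrow> ('a, 'n) proj_point \<Rightarrow> ('a, 'n) proj_point set"
  where "proj_line P R = points_of (vec.span {point_vec P, point_vec R})"

lemma independent_point_vec_pair: "P \<noteq> R \<Longrightarrow> vec.independent {point_vec P, point_vec R}"
  by (simp add: vec.independent_insert point_vec_mem_span_iff point_vec_neq_0)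

lemma dim_span_point_vec_pair:
  assumes "P \<noteq> R"
  shows "vec.dim (vec.span {point_vec P, point_vec R}) = 2"
  using independent_point_vec_pair[OF assms] assms
  by (subst vec.dim_span_eq_card_independent) (simp_all add: inj_eq[OF inj_point_vec])

lemma proj_line_mem_proj_subspaces_dim: "P \<noteq> R \<Longrightarrow> proj_line P R \<in> proj_subspaces_dim 1"
  unfolding proj_line_def proj_subspaces_dim_def using dim_span_point_vec_pair by fastforce

lemma mem_proj_line: "P \<in> proj_line P R" "R \<in> proj_line P R"
  by (simp_all add: proj_line_def mem_points_of_iff vec.span_base)

lemma proj_line_subset:
  assumes "V \<in> proj_subspaces" and "P \<in> V" and "R \<in> V"
  shows "proj_line P R \<subseteq> V"
proof -
  obtain U where U: "V = points_of U" "vec.subspace U"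
    using assms(1) by (auto simp: proj_subspaces_def)
  then have "vec.span {point_vec P, point_vec R} \<subseteq> U"
    using assms(2,3) by (simp add: mem_points_of_iff vec.span_minimal)
  then show ?thesis
    unfolding proj_line_def U(1) by (rule points_of_mono)
qed

lemma proj_line_eqI:
  assumes "V \<in> proj_subspaces_dim 1" and "P \<in> V" and "R \<in> V" and "P \<noteq> R"
  shows "proj_line P R = V"
proof -
  obtain U where U: "V = points_of U" "vec.subspace U" "vec.dim U = 2"
    using assms(1) by (auto simp: proj_subspaces_dim_def)
  then have "vec.span {point_vec P, point_vec R} \<subseteq> U"
    using assms(2,3) by (simp add: mem_points_of_iff vec.span_minimal)
  then have "vec.span {point_vec P, point_vec R} = U"
    using U(2,3) dim_span_point_vec_pair[OF assms(4)] by (intro vec.subspace_dim_equal) simp_all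
  then show ?thesis
    by (simp add: proj_line_def U(1))
qed

lemma card_cong_1_iff_dvd_card_Diff:
  assumes "finite A" and "x \<in> A"
  shows "[card A = 1] (mod m) \<longleftrightarrow> m dvd card (A - {x})"
proof -
  have "card A = card (A - {x}) + 1"
    using assms by (metis Suc_eq_plus1 card_Suc_Diff1)
  then have "[card A = 1] (mod m) \<longleftrightarrow> [card (A - {x}) + 1 = 0 + 1] (mod m)"
    by (simp only: add_0)
  then show ?thesis
    by (simp only: cong_add_rcancel_nat cong_0_iff)
qed

text \<open>The points of \<open>V \<inter> B\<close> other than \<open>R\<close> are partitioned by the lines through \<open>R\<close>.\<close>

lemma card_proj_subspace_Int_cong_1:
  fixes B :: "('a::{field, finite}, 'n::finite) proj_point set"
  assumes V: "V \<in> proj_subspaces" "R \<in> V" and "R \<in> B"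
    and lines: "\<And>L. L \<in> proj_subspaces_dim 1 \<Longrightarrow> R \<in> L \<Longrightarrow> [card (L \<inter> B) = 1] (mod m)"
  shows "[card (V \<inter> B) = 1] (mod m)"
proof -
  let ?Y = "V \<inter> B - {R}" and ?l = "\<lambda>P. proj_line P R"
  have "m dvd card {P' \<in> ?Y. ?l P' = ?l P}" if P: "P \<in> ?Y" for P
  proof -
    have line: "?l P \<in> proj_subspaces_dim 1"
      using P by (intro proj_line_mem_proj_subspaces_dim) simp
    have sub: "?l P \<subseteq> V"
      using P V by (intro proj_line_subset) auto
    have "?l P' = ?l P \<longleftrightarrow> P' \<in> ?l P" if "P' \<noteq> R" for P'
      using proj_line_eqI[OF line _ mem_proj_line(2) that] mem_proj_line(1)[of P' R] by metis
    then have "{P' \<in> ?Y. ?l P' = ?l P} = ?l P \<inter> B - {R}"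
      using sub by blast
    moreover have "m dvd card (?l P \<inter> B - {R})"
      using lines[OF line] mem_proj_line(2) assms(3)
      by (subst card_cong_1_iff_dvd_card_Diff [symmetric]) auto
    ultimately show ?thesis
      by simp
  qed
  then have "m dvd (\<Sum>L\<in>?l ` ?Y. card {P' \<in> ?Y. ?l P' = L})"
    by (intro dvd_sum) blast
  also have "\<dots> = card ?Y"
    using sum.image_gen[of ?Y "\<lambda>_. 1 :: nat" ?l] by simp
  finally show ?thesis
    using assms(3) V(2) by (subst card_cong_1_iff_dvd_card_Diff) auto
qed

section \<open>Linear maps into an extension field\<close>

text \<open>The kernel points of a nonzero linear map into an extension field of degree \<open>k\<close> are the
  trace on \<open>PG(n,q)\<close> of a hyperplane of \<open>PG(n,q\<^sup>k)\<close>.\<close>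

definition ker_points :: "('a::field ^ 'n::finite \<Rightarrow> 'b::zero) \<Rightarrow> ('a, 'n) proj_point set" where
  "ker_points f = points_of {v. f v = 0}"

context finite_field_extension
begin

lemma emb_0: "emb 0 = 0"
  using emb_add[of 0 0] by (metis add_0 add_cancel_right_left)

definition lin_maps :: "('a ^ 'n::finite) set \<Rightarrow> ('a ^ 'n \<Rightarrow> 'b) set" where
  "lin_maps L = {f. Vector_Spaces.linear (*s) (\<lambda>a y. emb a * y) f \<and> range f \<subseteq> K \<and> (\<forall>x\<in>L. f x = 0)}"

lemma mem_lin_maps_iff:
  "f \<in> lin_maps L \<longleftrightarrow> (\<forall>x y. f (x + y) = f x + f y) \<and> (\<forall>a x. f (a *s x) = emb a * f x) \<and>
    (\<forall>x. f x \<in> K) \<and> (\<forall>x\<in>L. f x = 0)"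
proof -
  have "vector_space (\<lambda>a y. emb a * y)"
    by unfold_locales (simp_all add: emb_1 emb_add emb_mult algebra_simps)
  then show ?thesis
    by (auto simp: lin_maps_def Vector_Spaces.linear_iff vec.vector_space_axioms)
qed

lemma finite_lin_maps: "finite (lin_maps (L :: ('a ^ 'n::finite) set))"
proof (rule finite_subset)
  show "lin_maps L \<subseteq> (UNIV :: ('a ^ 'n) set) \<rightarrow>\<^sub>E K"
    by (auto simp: lin_maps_def)
  show "finite ((UNIV :: ('a ^ 'n) set) \<rightarrow>\<^sub>E K)"
    using finite_K by (intro finite_PiE) auto
qed

lemma zero_mem_lin_maps: "(\<lambda>_. 0) \<in> lin_maps L"
  using zero_mem by (simp add: mem_lin_maps_iff)

lemma add_functional_mem_lin_maps:
  assumes "f \<in> lin_maps L" and "Vector_Spaces.linear (*s) (*) g" and "\<And>x. x \<in> L \<Longrightarrow> g x = 0"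
    and "u \<in> K"
  shows "(\<lambda>x. f x + emb (g x) * u) \<in> lin_maps L"
  using assms emb_mem add_mem mult_mem
  by (auto simp: mem_lin_maps_iff Vector_Spaces.linear_iff emb_0 emb_add emb_mult algebra_simps)

lemma add_sum_functionals_mem_lin_maps:
  assumes "f \<in> lin_maps L" and "u \<in> J \<rightarrow> K" and "\<And>j. j \<in> J \<Longrightarrow> Vector_Spaces.linear (*s) (*) (g j)"
    and "\<And>j x. j \<in> J \<Longrightarrow> x \<in> L \<Longrightarrow> g j x = 0"
  shows "(\<lambda>x. f x + (\<Sum>j\<in>J. emb (g j x) * u j)) \<in> lin_maps L"
  using assms(2-)
proof (induction J rule: infinite_finite_induct)
  case (insert j J)
  then have "(\<lambda>x. f x + (\<Sum>j\<in>J. emb (g j x) * u j) + emb (g j x) * u j) \<in> lin_maps L"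
    by (intro add_functional_mem_lin_maps) auto
  then show ?case
    using insert.hyps by (simp add: add_ac)
qed (simp_all add: assms(1))

lemma card_lin_maps:
  assumes "vec.subspace L" and "x \<notin> L"
  shows "card (lin_maps L) = card K * card {f \<in> lin_maps L. f x = 0}"
proof -
  obtain g where g: "Vector_Spaces.linear (*s) (*) g" "g x = 1" "\<And>u. u \<in> L \<Longrightarrow> g u = 0"
    using vec.exists_linear_functional[OF assms] by metis
  note add = add_functional_mem_lin_maps[OF _ g(1,3)]
  let ?Z = "{f \<in> lin_maps L. f x = 0}"
  have "bij_betw (\<lambda>(u, f) v. f v + emb (g v) * u) (K \<times> ?Z) (lin_maps L)"
  proof (rule bij_betwI[where g = "\<lambda>f. (f x, \<lambda>v. f v + emb (g v) * - f x)"])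
    show "(\<lambda>f. (f x, \<lambda>v. f v + emb (g v) * - f x)) \<in> lin_maps L \<rightarrow> K \<times> ?Z"
    proof
      fix f assume f: "f \<in> lin_maps L"
      then have "f x \<in> K"
        by (simp add: mem_lin_maps_iff)
      then show "(f x, \<lambda>v. f v + emb (g v) * - f x) \<in> K \<times> ?Z"
        using add[OF f _ uminus_mem] g(2) by (simp add: emb_1)
    qed
  qed (use add g(2) in \<open>auto simp: emb_1\<close>)
  then show ?thesis
    by (simp add: bij_betw_same_card [symmetric] card_cartesian_product)
qed

lemma subspace_kernel:
  assumes "f \<in> lin_maps L"
  shows "vec.subspace {v. f v = 0}"
proof (rule vec.subspaceI)
  show "0 \<in> {v. f v = 0}"
    using assms by (simp add: mem_lin_maps_iff) (metis add_cancel_right_left)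
qed (use assms in \<open>simp_all add: mem_lin_maps_iff\<close>)

lemma mem_ker_points_iff: "f \<in> lin_maps L \<Longrightarrow> P \<in> ker_points f \<longleftrightarrow> f (point_vec P) = 0"
  by (simp add: ker_points_def mem_points_of_iff subspace_kernel)

lemma CARD_le_dim_kernel:
  fixes f :: "'a ^ 'n::finite \<Rightarrow> 'b"
  assumes "f \<in> lin_maps L"
  shows "CARD('n) \<le> k + vec.dim {v. f v = 0}"
proof -
  have "Modules.additive f" and "range f \<subseteq> K"
    using assms by (auto simp: mem_lin_maps_iff Modules.additive_def)
  then have "CARD('a ^ 'n) \<le> card K * card {v. f v = 0}"
    using card_range_mult_card_kernel[of f] card_mono[OF finite_K] by (metis mult_le_mono1)
  also have "\<dots> = CARD('a) ^ (k + vec.dim {v. f v = 0})"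
    using vec.card_subspace[OF subspace_kernel[OF assms]] by (simp add: card_K power_add)
  finally have "CARD('a) ^ CARD('n) \<le> CARD('a) ^ (k + vec.dim {v. f v = 0})"
    by simp
  then show ?thesis
    using CARD_gt_1[where 'a = 'a] by simp
qed

lemma exists_proj_subspace_subset_ker_points:
  fixes L :: "('a ^ 'n::finite) set"
  assumes n: "CARD('n) = n + 1" "k \<le> n"
    and "f \<in> lin_maps L" and "vec.dim L \<le> n - k + 1"
  obtains V where "V \<in> proj_subspaces_dim (n - k)" "points_of L \<subseteq> V" "V \<subseteq> ker_points f"
proof -
  have "L \<subseteq> {v. f v = 0}"
    using assms(3) by (auto simp: mem_lin_maps_iff)
  moreover have "n - k + 1 \<le> vec.dim {v. f v = 0}"
    using CARD_le_dim_kernel[OF assms(3)] n by simp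
  ultimately obtain U where "vec.subspace U" "L \<subseteq> U" "U \<subseteq> {v. f v = 0}" "vec.dim U = n - k + 1"
    using vec.exists_subspace_between[OF subspace_kernel[OF assms(3)]] assms(4) by blast
  then have "points_of U \<in> proj_subspaces_dim (n - k)" "points_of L \<subseteq> points_of U"
    "points_of U \<subseteq> ker_points f"
    unfolding ker_points_def by (auto simp: proj_subspaces_dim_def intro!: points_of_mono)
  then show thesis
    by (rule that)
qed

text \<open>Every point outside \<open>L\<close> is a kernel point of exactly a fraction \<open>1 / \<bar>K\<bar>\<close> of the maps
  vanishing on \<open>L\<close>.\<close>

lemma exists_lin_map_few_ker_points:
  fixes L :: "('a ^ 'n::finite) set"
  assumes L: "vec.subspace L" and card: "card (B - points_of L) < m * card K"
  shows "\<exists>f\<in>lin_maps L. card (ker_points f \<inter> B - points_of L) < m"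
proof (rule ccontr)
  let ?M = "lin_maps L" and ?A = "B - points_of L"
  assume few: "\<not> ?thesis"
  then have many: "m \<le> card {P \<in> ?A. f (point_vec P) = 0}" if f: "f \<in> ?M" for f
  proof -
    have "{P \<in> ?A. f (point_vec P) = 0} = ker_points f \<inter> B - points_of L"
      using f by (auto simp: mem_ker_points_iff)
    then show ?thesis
      using f few by (metis not_le)
  qed
  have "card ?M > 0"
    using finite_lin_maps zero_mem_lin_maps by (auto simp: card_gt_0_iff)
  have "card K * (\<Sum>f\<in>?M. card {P \<in> ?A. f (point_vec P) = 0})
      = card K * (\<Sum>P\<in>?A. card {f \<in> ?M. f (point_vec P) = 0})"
    using sum_multicount_gen[OF finite_lin_maps[of L], of ?A "\<lambda>f P. f (point_vec P) = 0"] by simp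
  also have "\<dots> = (\<Sum>P\<in>?A. card ?M)"
    by (simp add: sum_distrib_left mem_points_of_iff[OF L] card_lin_maps[OF L, symmetric])
  also have "\<dots> < m * card K * card ?M"
    using card \<open>card ?M > 0\<close> by simp
  also have "\<dots> = card K * (\<Sum>f\<in>?M. m)"
    by simp
  also have "\<dots> \<le> card K * (\<Sum>f\<in>?M. card {P \<in> ?A. f (point_vec P) = 0})"
    using many by (intro mult_left_mono sum_mono) auto
  finally show False
    by simp
qed

lemma exists_proj_subspace_few_extra_points:
  fixes L :: "('a ^ 'n::finite) set"
  assumes n: "CARD('n) = n + 1" "k \<le> n"
    and L: "vec.subspace L" "vec.dim L \<le> n - k + 1" and "card (B - points_of L) < m * card K"
  shows "\<exists>f\<in>lin_maps L. \<exists>V\<in>proj_subspaces_dim (n - k).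
    points_of L \<subseteq> V \<and> V \<subseteq> ker_points f \<and> card (ker_points f \<inter> B - points_of L) < m"
  using exists_lin_map_few_ker_points[OF L(1) assms(5)]
    exists_proj_subspace_subset_ker_points[OF n _ L(2)] by metis

text \<open>Perturbing \<open>f\<close> by \<open>K\<close>-multiples of functionals dual to the points of \<open>J\<close> keeps the other
  points of \<open>B\<close> out of the kernel for a suitable choice of coefficients that are not all zero.\<close>

lemma exists_lin_map_fewer_ker_points:
  fixes f :: "'a ^ 'n::finite \<Rightarrow> 'b"
  assumes f: "f \<in> lin_maps L" and J: "ker_points f \<inter> B = J"
    and independent: "vec.independent (point_vec ` J)"
    and card: "card (B - J) < card J * (card K - 1)"
  obtains F where "F \<in> lin_maps {}" "ker_points F \<inter> B \<subset> J"
proof -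
  obtain g where g: "\<And>P. Vector_Spaces.linear (*s) (*) (g P)"
    "\<And>P R. P \<in> J \<Longrightarrow> R \<in> J \<Longrightarrow> g P (point_vec R) = of_bool (R = P)"
    using vec.exists_dual_functionals[OF independent inj_on_subset[OF inj_point_vec subset_UNIV]]
    by metis
  have "f (point_vec P) \<noteq> 0" if "P \<in> B - J" for P
    using that J mem_ker_points_iff[OF f] by auto
  then obtain u where u: "u \<in> J \<rightarrow> K" "\<exists>j\<in>J. u j \<noteq> 0"
    "\<And>P. P \<in> B - J \<Longrightarrow> f (point_vec P) + (\<Sum>j\<in>J. emb (g j (point_vec P)) * u j) \<noteq> 0"
    using affine_functions_common_nonzero[of J "B - J" "\<lambda>P. f (point_vec P)"
        "\<lambda>P j. emb (g j (point_vec P))"] card by auto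
  define F where "F = (\<lambda>x. f x + (\<Sum>j\<in>J. emb (g j x) * u j))"
  have "f \<in> lin_maps {}"
    using f by (simp add: lin_maps_def)
  then have F: "F \<in> lin_maps {}"
    unfolding F_def using u(1) g(1) by (intro add_sum_functionals_mem_lin_maps) auto
  have emb_of_bool: "emb (of_bool b) = of_bool b" for b
    by (simp add: emb_0 emb_1)
  have "F (point_vec R) = u R" if "R \<in> J" for R
  proof -
    have "R \<in> ker_points f"
      using that J by blast
    then have "F (point_vec R) = (\<Sum>j\<in>J. of_bool (R = j) * u j)"
      using that g(2) by (simp add: F_def mem_ker_points_iff[OF f] emb_of_bool)
    also have "\<dots> = u R"
      using that by (simp add: Int_absorb2)
    finally show ?thesis .
  qed
  then obtain R where "R \<in> J" "R \<notin> ker_points F"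
    using u(2) by (auto simp: mem_ker_points_iff[OF F])
  moreover have "F (point_vec P) \<noteq> 0" if "P \<in> B - J" for P
    using u(3)[OF that] by (simp add: F_def)
  then have "ker_points F \<inter> B \<subseteq> J"
    using mem_ker_points_iff[OF F] by blast
  ultimately show thesis
    using that F by blast
qed

section \<open>Point sets meeting subspaces in one point modulo m\<close>

lemma card_Int_cong_1_or_extension:
  fixes B :: "('a, 'n::finite) proj_point set"
  assumes n: "CARD('n) = n + 1" "k \<le> n" and card: "card B < 2 * card K"
    and B: "\<And>V. V \<in> proj_subspaces_dim (n - k) \<Longrightarrow> [card (V \<inter> B) = 1] (mod m)"
    and Y: "Y \<in> proj_subspaces_dim d" "d \<le> n - k"
  shows "[card (Y \<inter> B) = 1] (mod m) \<or> m dvd card (Y \<inter> B) \<and>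
    (\<exists>V\<in>proj_subspaces. \<exists>S. Y \<subseteq> V \<and> S \<notin> Y \<and> V \<inter> B = insert S (Y \<inter> B))"
proof -
  obtain L where L: "Y = points_of L" "vec.subspace L" "vec.dim L = d + 1"
    using Y(1) by (auto simp: proj_subspaces_dim_def)
  have "card (B - Y) < 2 * card K"
    using card by (metis card_mono finite Diff_subset le_less_trans)
  then obtain f V where "f \<in> lin_maps L"
    and V: "V \<in> proj_subspaces_dim (n - k)" "Y \<subseteq> V" "V \<subseteq> ker_points f"
    and few: "card (ker_points f \<inter> B - Y) < 2"
    using exists_proj_subspace_few_extra_points[OF n L(2), of B 2] L(3) Y(2) unfolding L(1) by auto
  have "card (V \<inter> B - Y) \<le> card (ker_points f \<inter> B - Y)"
    using V(3) by (intro card_mono) auto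
  then consider (no_extra_point) "V \<inter> B - Y = {}" | (one_extra_point) S where "V \<inter> B - Y = {S}"
    using few by (metis One_nat_def card_0_eq card_1_singletonE finite le_less_trans less_2_cases)
  then show ?thesis
  proof cases
    case no_extra_point
    then have "V \<inter> B = Y \<inter> B"
      using V(2) by blast
    then show ?thesis
      using B[OF V(1)] by simp
  next
    case (one_extra_point S)
    then have S: "S \<notin> Y" "V \<inter> B = insert S (Y \<inter> B)"
      using V(2) by blast+
    then have "m dvd card (V \<inter> B - {S})"
      using B[OF V(1)] by (subst card_cong_1_iff_dvd_card_Diff [symmetric]) auto
    moreover have "V \<inter> B - {S} = Y \<inter> B"
      using S by blast
    ultimately have "m dvd card (Y \<inter> B)"
      by simp
    then show ?thesis
      using S V(1,2) proj_subspaces_dim_subset_proj_subspaces by blast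
  qed
qed

text \<open>If the line \<open>L\<close> extended by an extra point \<open>S\<close>, the line through \<open>R\<close> and \<open>S\<close> would meet
  \<open>B\<close> in exactly two points, and \<open>2\<close> is neither \<open>0\<close> nor \<open>1\<close> modulo \<open>m\<close>.\<close>

lemma card_line_Int_cong_1:
  fixes B :: "('a, 'n::finite) proj_point set"
  assumes n: "CARD('n) = n + 1" "k + 1 \<le> n" and card: "card B < 2 * card K" and "m > 2"
    and B: "\<And>V. V \<in> proj_subspaces_dim (n - k) \<Longrightarrow> [card (V \<inter> B) = 1] (mod m)"
    and L: "L \<in> proj_subspaces_dim 1" and R: "R \<in> L" "R \<in> B"
  shows "[card (L \<inter> B) = 1] (mod m)"
proof (rule ccontr)
  have "k \<le> n" and "1 \<le> n - k"
    using n(2) by simp_all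
  note dichotomy = card_Int_cong_1_or_extension[OF n(1) this(1) card B _ this(2)]
  assume "\<not> ?thesis"
  then obtain V S where V: "V \<in> proj_subspaces" "L \<subseteq> V" "S \<notin> L" "V \<inter> B = insert S (L \<inter> B)"
    using dichotomy[OF _ L] by blast
  let ?M = "proj_line R S"
  have "R \<noteq> S"
    using R V(3) by blast
  then have M: "?M \<in> proj_subspaces_dim 1"
    by (rule proj_line_mem_proj_subspaces_dim)
  have "?M \<inter> L \<subseteq> {R}"
    using proj_line_eqI[OF M mem_proj_line(1)] proj_line_eqI[OF L R(1)] mem_proj_line(2)[of S R] V(3)
    by blast
  moreover have "?M \<subseteq> V"
    using V R proj_line_subset by blast
  ultimately have "?M \<inter> B = {R, S}"
    using V(4) R mem_proj_line[of R S] mem_proj_line[of S R] by blast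
  then have "card (?M \<inter> B) = 2"
    using \<open>R \<noteq> S\<close> by simp
  then have "[2 = 1] (mod m) \<or> m dvd 2"
    using dichotomy[OF _ M] by auto
  then show False
    using \<open>m > 2\<close> by (auto simp: Cong.cong_def dest: dvd_imp_le)
qed

end

section \<open>Codewords of small weight\<close>

lemma sum_on_eq_sum_supp: "sum_on c S = (\<Sum>P\<in>S \<inter> supp c. c $ P)"
  unfolding sum_on_def by (rule sum.mono_neutral_right) (auto simp: supp_def)

lemma sum_on_incidence_vec:
  "sum_on (incidence_vec S :: 'f::comm_semiring_1 ^ 'i::finite) T = of_nat (card (S \<inter> T))"
  by (simp add: sum_on_def incidence_vec_def sum.If_cases Int_commute)

lemma sum_on_subspace_code_eq:
  fixes c :: "'f::field ^ ('a::{field, finite}, 'n::finite) proj_point"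
  assumes "CHAR('f) dvd CARD('a)" and n: "CARD('n) = n + 1" "k \<le> n" and c: "c \<in> subspace_code k"
    and VY: "V \<in> proj_subspaces_dim (n - k)" "Y \<in> proj_subspaces_dim (n - k)"
  shows "sum_on c V = sum_on c Y"
proof -
  let ?E = "{c :: 'f ^ ('a, 'n) proj_point. sum_on c V = sum_on c Y}"
  have "sum_on (incidence_vec A :: 'f ^ ('a, 'n) proj_point) Z = 1"
    if "A \<in> proj_subspaces_dim k" "Z \<in> proj_subspaces_dim (n - k)" for A Z
  proof -
    have "[card (A \<inter> Z) = 1] (mod CHAR('f))"
      using card_proj_subspaces_Int_cong_1[OF n that] assms(1) by (rule cong_dvd_modulus_nat)
    then have "of_nat (card (A \<inter> Z)) = (of_nat 1 :: 'f)"
      by (simp only: of_nat_eq_iff_cong_CHAR)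
    then show ?thesis
      by (simp add: sum_on_incidence_vec)
  qed
  then have "incidence_vec ` proj_subspaces_dim k \<subseteq> ?E"
    using VY by auto
  moreover have "vec.subspace ?E"
    by (rule vec.subspaceI) (auto simp: sum_on_def sum.distrib simp flip: sum_distrib_left)
  ultimately have "subspace_code k \<subseteq> ?E"
    unfolding subspace_code_def by (rule vec.span_minimal)
  then show ?thesis
    using c by blast
qed

lemma (in finite_field_extension) coeff_eq_sum_on:
  fixes c :: "'f::field ^ ('a, 'n::finite) proj_point"
  assumes n: "CARD('n) = n + 1" "k \<le> n" and small_weight: "weight c < 2 * card K"
    and sum: "\<And>V. V \<in> proj_subspaces_dim (n - k) \<Longrightarrow> sum_on c V = \<alpha>" and "\<alpha> \<noteq> 0"
    and R: "R \<in> supp c"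
  shows "c $ R = \<alpha>"
proof (rule ccontr)
  assume neq: "c $ R \<noteq> \<alpha>"
  let ?B = "supp c" and ?L = "vec.span {point_vec R}"
  note point_R = points_of_span_point_vec[of R]
  have "card (?B - {R}) < 2 * card K"
    using small_weight unfolding weight_def by (metis card_Diff1_le le_less_trans)
  moreover have "vec.dim ?L \<le> n - k + 1"
    by (simp add: vec.dim_insert vec.span_eq_dim)
  ultimately obtain f V where f: "f \<in> lin_maps ?L" "card (ker_points f \<inter> ?B - {R}) < 2"
    and V: "V \<in> proj_subspaces_dim (n - k)" "R \<in> V" "V \<subseteq> ker_points f"
    using exists_proj_subspace_few_extra_points[OF n vec.subspace_span, of "{point_vec R}" ?B 2]
    unfolding point_R by auto
  have "V \<inter> ?B \<noteq> {R}"
    using sum[OF V(1)] neq by (auto simp: sum_on_eq_sum_supp)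
  then obtain S where S: "S \<in> V" "S \<in> ?B" "S \<noteq> R"
    using V(2) R by blast
  have "{S} = ker_points f \<inter> ?B - {R}"
    using S V(3) f(2) by (intro card_seteq) auto
  then have ker: "ker_points f \<inter> ?B = {R, S}" and VB: "V \<inter> ?B = {R, S}"
    using R S V(2,3) by blast+
  have coeff_sum: "c $ R + c $ S = \<alpha>"
    using sum[OF V(1)] VB S(3) by (simp add: sum_on_eq_sum_supp)
  have "card (?B - {R, S}) + 2 = weight c"
    unfolding weight_def using R S(2,3) card_Diff_subset[of "{R, S}" ?B] card_mono[of ?B "{R, S}"]
    by simp
  then have "card (?B - {R, S}) < card {R, S} * (card K - 1)"
    using small_weight S(3) by simp
  then obtain F where F: "F \<in> lin_maps {}" "ker_points F \<inter> ?B \<subset> {R, S}"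
    using exists_lin_map_fewer_ker_points[OF f(1) ker] independent_point_vec_pair[OF S(3)]
    by (auto simp: insert_commute)
  obtain Y where Y: "Y \<in> proj_subspaces_dim (n - k)" "Y \<subseteq> ker_points F"
    using exists_proj_subspace_subset_ker_points[OF n F(1)] by (metis vec.dim_empty zero_le)
  then have "Y \<inter> ?B \<in> {{}, {R}, {S}}"
    using F(2) by blast
  then have "\<alpha> \<in> {0, c $ R, c $ S}"
    using sum[OF Y(1)] by (auto simp: sum_on_eq_sum_supp)
  then show False
    using neq \<open>\<alpha> \<noteq> 0\<close> coeff_sum R by (auto simp: supp_def)
qed

lemma card_Int_supp_cong_1:
  fixes c :: "'f::idom ^ 'i::finite"
  assumes "\<And>P. P \<in> supp c \<Longrightarrow> c $ P = \<alpha>" and "\<alpha> \<noteq> 0" and "sum_on c V = \<alpha>"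
  shows "[card (V \<inter> supp c) = 1] (mod CHAR('f))"
proof -
  have "of_nat (card (V \<inter> supp c)) * \<alpha> = \<alpha>"
    using assms(1,3) by (simp add: sum_on_eq_sum_supp)
  then have "of_nat (card (V \<inter> supp c)) = (of_nat 1 :: 'f)"
    using assms(2) by simp
  then show ?thesis
    by (simp only: of_nat_eq_iff_cong_CHAR)
qed

theorem theorem3p4:
  fixes p h q n k :: nat
    and c :: "'f::{field, finite} ^ ('a::{field, finite}, 'n::finite) proj_point"
    and S T :: "('a, 'n) proj_point set"
  assumes "prime p" and "p > 3" and "h \<ge> 1" and "q = p ^ h"
    and "n \<ge> 2" and "1 \<le> k" and "k \<le> n - 1"
    and "CARD('a) = q" and "CARD('n) = n + 1" and "CARD('f) = p"
    and "c \<in> subspace_code k"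
    and "weight c < 2 * q ^ k"
    and "S \<in> proj_subspaces_dim (n - k)" and "sum_on c S \<noteq> 0"
    and "T \<in> proj_subspaces" and "T \<inter> supp c \<noteq> {}"
  shows "[card (T \<inter> supp c) = 1] (mod p)"
proof -
  have CHAR: "CHAR('a) = p" "CHAR('f) = p"
    using assms CHAR_eq_if_CARD_eq_prime_power[of p] power_one_right by metis+
  let ?K = "{x :: 'a alg_closure. x ^ (CARD('a) ^ k) = x}"
  interpret finite_field_extension ?K "to_ac :: 'a \<Rightarrow> 'a alg_closure" k
    using assms CHAR by (intro finite_field_extension_to_ac) auto
  have n: "CARD('n) = n + 1" "k \<le> n" "k + 1 \<le> n" and "p > 2"
    using assms by simp_all
  have weight: "weight c < 2 * card ?K"
    unfolding card_K using assms by simp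
  have "CHAR('f) dvd CARD('a)"
    using assms CHAR by (simp add: dvd_power)
  then have sum: "sum_on c V = sum_on c S" if "V \<in> proj_subspaces_dim (n - k)" for V
    using sum_on_subspace_code_eq n(1,2) assms(11) that assms(13) by blast
  then have coeff: "c $ P = sum_on c S" if "P \<in> supp c" for P
    using coeff_eq_sum_on n(1,2) weight assms(14) that by blast
  have "[card (V \<inter> supp c) = 1] (mod p)" if "V \<in> proj_subspaces_dim (n - k)" for V
    using card_Int_supp_cong_1[OF coeff assms(14) sum[OF that]] by (simp add: CHAR)
  then have "[card (L \<inter> supp c) = 1] (mod p)"
    if "L \<in> proj_subspaces_dim 1" "R \<in> L" "R \<in> supp c" for L R
    using card_line_Int_cong_1 n(1,3) weight \<open>p > 2\<close> that unfolding weight_def by blast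
  then show ?thesis
    using card_proj_subspace_Int_cong_1 assms(15,16) by blast
qed

end
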